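(* Let $n\ge1$ and let $\pi$ be any permutation of $\{0,1,\dots,n-1\}$. Then the words $u=0\,1\,\cdots\,(n-1)$ and $v=\pi(0)\,\pi(1)\,\cdots\,\pi(n-1)$ over the alphabet $\{0,1,\dots,n-1\}$ are cyclically equalizable.
   Context: Two words $x=x_0\cdots x_{N-1}$, $y$ of length $N$ are cyclically equivalent if $y=x_rx_{r+1}\cdots x_{N-1}x_0\cdots x_{r-1}$ for some integer $r$. Given words $w_1,w_2\in\Sigma^n$ with $w_i=a_{i,0}\cdots a_{i,n-1}$, a simultaneous insertion transforms each $w_i$ into $x_0a_{i,0}x_1a_{i,1}\cdots x_{n-1}a_{i,n-1}x_n$, where the words $x_0,\dots,x_n\in\Sigma^*$ are the same for both $i$. Two words of equal length are cyclically equalizable if some simultaneous insertion transforms them into cyclically equivalent words. *)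

theory Defs
  imports Main "HOL-Combinatorics.Permutations"
begin

(* rotate acts modulo the length, so a natural number r covers every integer shift. *)
definition cyclically_equivalent :: "'a list \<Rightarrow> 'a list \<Rightarrow> bool" where
  "cyclically_equivalent x y \<longleftrightarrow> (\<exists>r. y = rotate r x)"

(* x 0 a_0 x 1 a_1 ... x (n-1) a_(n-1) x n, where w = a_0 ... a_(n-1);
   the values x i for i > n are irrelevant. *)
definition insertion :: "(nat \<Rightarrow> 'a list) \<Rightarrow> 'a list \<Rightarrow> 'a list" where
  "insertion x w = concat (map (\<lambda>i. x i @ [w ! i]) [0..<length w]) @ x (length w)"

(* The inserted words must be over the same alphabet S as the two given words. *)
definition cyclically_equalizable :: "'a set \<Rightarrow> 'a list \<Rightarrow> 'a list \<Rightarrow> bool" where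
  "cyclically_equalizable S w1 w2 \<longleftrightarrow>
     w1 \<in> lists S \<and> w2 \<in> lists S \<and> length w1 = length w2 \<and>
     (\<exists>x. (\<forall>i\<le>length w1. x i \<in> lists S) \<and>
          cyclically_equivalent (insertion x w1) (insertion x w2))"

end

theory Submission
  imports Defs "HOL-Combinatorics.Orbits"
begin

text \<open>
  Let the inserted words have length \<open>N\<close> and differ by a rotation by \<open>r\<close>. Walking
  around the circle of \<open>N\<close> positions in steps of \<open>r\<close>, the letter changes only at the
  positions of the original letters, from \<open>i\<close> to \<open>\<pi> i\<close>. So the original
  positions on an orbit of the rotation, if any, must spell a cycle of \<open>\<pi>\<close>. Take \<open>N = n^3 + n\<close>
  and \<open>r = n^2\<close>: there are \<open>n\<close> orbits, namely the residue classes mod \<open>n\<close>, and each orbit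
  consists of \<open>n\<close> sweeps around the circle, every sweep being displaced from the previous
  one by \<open>n\<close> positions. Each cycle of \<open>\<pi>\<close> is assigned to the orbit of its least element \<open>c\<close>. If
  \<open>i = \<pi>\<^sup>-\<^sup>s c\<close>, the letter \<open>i\<close> is put at the position with base-\<open>n\<close> digits \<open>(i, s, c)\<close>;
  the leading digit makes the positions increase with \<open>i\<close>, and along an orbit the sweep
  number \<open>s\<close> decreases, so that the letters are met in the order of the cycle.
\<close>

text \<open>The marks \<open>p i\<close> are the positions of the given letters in the final word of
  length \<open>N\<close>. The filler \<open>f\<close> never looks at those letters, so the same
  gaps serve both words.\<close>

definition gap :: "(nat \<Rightarrow> nat) \<Rightarrow> (nat \<Rightarrow> 'a) \<Rightarrow> nat \<Rightarrow> nat \<Rightarrow> nat \<Rightarrow> 'a list" where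
  "gap p f n N i =
     map f [if i = 0 then 0 else Suc (p (i - 1)) ..< if i < n then p i else N]"

text \<open>Turns an insertion into the table of a function on positions, so that two results can be
  compared pointwise. \<open>F\<close> may vary with the word, but only at the marks.\<close>

lemma insertion_gap:
  assumes mono: "strict_mono_on {..<n} p"
    and bound: "\<And>i. i < n \<Longrightarrow> p i < N"
    and len: "length w = n"
    and marked: "\<And>i. i < n \<Longrightarrow> F (p i) = w ! i"
    and unmarked: "\<And>j. j < N \<Longrightarrow> j \<notin> p ` {..<n} \<Longrightarrow> F j = f j"
  shows "insertion (gap p f n N) w = map F [0..<N]"
proof -
  define P where "P i = (if i = 0 then 0 else Suc (p (i - 1)))" for i
  have less: "p i < p j" if "i < j" "j < n" for i j
    using strict_mono_onD[OF mono] that by simp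
  have not_marked: "j \<notin> p ` {..<n}" if "i \<le> n" "P i \<le> j" "i < n \<Longrightarrow> j < p i" for i j
  proof
    assume "j \<in> p ` {..<n}"
    then obtain k where k: "k < n" "j = p k" by auto
    show False
    proof (cases "k < i")
      case True
      then have "p k \<le> p (i - 1)"
        using less[of k "i - 1"] that(1) by (cases "k = i - 1") (simp, linarith)
      with True that(2) k show False by (simp add: P_def)
    next
      case False
      with k have "i < n" "p i \<le> p k" using less[of i k] by (cases "k = i"; simp)+
      with that(3) k show False by simp
    qed
  qed
  have gap: "gap p f n N i = map F [P i ..< if i < n then p i else N]" if "i \<le> n" for i
    unfolding gap_def P_def[symmetric]
  proof (rule map_cong[OF refl])
    fix j assume "j \<in> set [P i ..< if i < n then p i else N]"
    then have j: "P i \<le> j" "j < (if i < n then p i else N)" by auto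
    then have "j < N" using bound[of i] by (auto split: if_splits)
    moreover have "j \<notin> p ` {..<n}" using not_marked[OF that j(1)] j(2) by presburger
    ultimately show "f j = F j" using unmarked by simp
  qed
  have P_le: "P i \<le> p i" if "i < n" for i
    using less[of "i - 1" i] that by (cases "i = 0") (auto simp: P_def)
  have "concat (map (\<lambda>i. gap p f n N i @ [w ! i]) [0..<k]) = map F [0..<P k]" if "k \<le> n" for k
    using that
  proof (induction k)
    case 0
    then show ?case by (simp add: P_def)
  next
    case (Suc k)
    then have k: "k < n" by simp
    have "[0..<P (Suc k)] = [0..<P k] @ [P k..<p k] @ [p k]"
      using upt_add_eq_append[of 0 "P k" "p k - P k"] P_le[OF k] by (simp add: P_def)
    with Suc k show ?case by (simp add: gap marked)
  qed
  moreover have "P n \<le> N" using bound[of "n - 1"] by (cases "n = 0") (auto simp: P_def Suc_le_eq)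
  then have "[0..<N] = [0..<P n] @ [P n..<N]"
    using upt_add_eq_append[of 0 "P n" "N - P n"] by simp
  ultimately show ?thesis by (simp add: insertion_def len gap)
qed

text \<open>Coordinates for the cycle decomposition: \<open>c\<close> names the cycle,
  \<open>s\<close> counts the steps from \<open>c\<close>. The bound \<open>L c \<le> n\<close> lets
  \<open>s\<close> serve as a base-\<open>n\<close> digit.\<close>

lemma permutes_cycle_coordinates:
  fixes \<sigma> :: "nat \<Rightarrow> nat"
  assumes perm: "\<sigma> permutes {0..<n}"
  obtains L where "\<And>c. c < n \<Longrightarrow> L c \<le> n"
    and "\<And>c. (\<sigma> ^^ L c) c = c"
    and "\<And>i. i < n \<Longrightarrow> \<exists>s c. c < n \<and> s < L c \<and> (\<sigma> ^^ s) c = i"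
    and "\<And>c d s t. s < L c \<Longrightarrow> t < L d \<Longrightarrow> (\<sigma> ^^ s) c = (\<sigma> ^^ t) d \<Longrightarrow> s = t \<and> c = d"
proof -
  have "permutation \<sigma>" using perm permutation_permutes by blast
  then have self: "c \<in> orbit \<sigma> c" for c by (rule permutation_self_in_orbit)
  define l where "l c = funpow_dist1 \<sigma> c c" for c
  \<comment> \<open>Only the least element of a cycle receives a positive length, so that each cycle is
    enumerated once.\<close>
  define L where "L c = (if \<forall>x\<in>orbit \<sigma> c. c \<le> x then l c else 0)" for c
  have l_pos: "0 < l c" for c by (simp add: l_def)
  have l_eq: "(\<sigma> ^^ l c) c = c" for c
    unfolding l_def using funpow_dist1_prop[OF self] .
  have orbit_eq: "orbit \<sigma> c = (\<lambda>s. (\<sigma> ^^ s) c) ` {0..<l c}" for c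
    unfolding l_def using orbit_conv_funpow_dist1[OF self] .
  have inj: "inj_on (\<lambda>s. (\<sigma> ^^ s) c) {0..<l c}" for c
    unfolding l_def using inj_on_funpow_dist1[OF self] .
  have orbit_cong: "orbit \<sigma> y = orbit \<sigma> c" if "y \<in> orbit \<sigma> c" for c y
    using that self by (metis orbit_cyclic_eq3 cyclic_on_def)
  have sub: "orbit \<sigma> c \<subseteq> {0..<n}" if "c < n" for c
    using permutes_orbit_subset[OF perm] that by simp
  show ?thesis
  proof (rule that[of L])
    fix c assume "c < n"
    have "l c = card (orbit \<sigma> c)" by (simp add: orbit_eq card_image[OF inj])
    also have "\<dots> \<le> n" using card_mono[OF _ sub[OF \<open>c < n\<close>]] by simp
    finally show "L c \<le> n" by (simp add: L_def)
  next
    fix c show "(\<sigma> ^^ L c) c = c" by (simp add: L_def l_eq)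
  next
    fix i assume i: "i < n"
    define c where "c = Min (orbit \<sigma> i)"
    have fin: "finite (orbit \<sigma> i)" by (simp add: orbit_eq)
    have c: "c \<in> orbit \<sigma> i" unfolding c_def using Min_in[OF fin] self by blast
    have "orbit \<sigma> c = orbit \<sigma> i" using orbit_cong[OF c] .
    moreover have "\<forall>x\<in>orbit \<sigma> i. c \<le> x" unfolding c_def using fin by simp
    ultimately have "L c = l c" "i \<in> orbit \<sigma> c" using self by (auto simp: L_def)
    with sub[OF i] c show "\<exists>s c. c < n \<and> s < L c \<and> (\<sigma> ^^ s) c = i"
      unfolding orbit_eq[of c] by fastforce
  next
    fix c d s t assume *: "s < L c" "t < L d" "(\<sigma> ^^ s) c = (\<sigma> ^^ t) d"
    then have min: "\<forall>x\<in>orbit \<sigma> c. c \<le> x" "\<forall>x\<in>orbit \<sigma> d. d \<le> x"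
      and lt: "s < l c" "t < l d" by (auto simp: L_def split: if_splits)
    have "(\<sigma> ^^ s) c \<in> orbit \<sigma> c" "(\<sigma> ^^ t) d \<in> orbit \<sigma> d"
      using lt by (auto simp: orbit_eq)
    then have "orbit \<sigma> c = orbit \<sigma> d" using orbit_cong *(3) by metis
    with min self have "c = d" by (metis order_antisym)
    with * lt inj[of c] show "s = t \<and> c = d" by (auto dest: inj_onD)
  qed
qed

lemma digits:
  fixes n :: nat
  assumes "s < n" "c < n"
  shows "((q * n + s) * n + c) mod n = c"
    and "((q * n + s) * n + c) div n mod n = s"
    and "((q * n + s) * n + c) div (n * n) = q"
  using assms by (auto simp: div_mult2_eq)

theorem theorem5:
  fixes n :: nat and \<pi> :: "nat \<Rightarrow> nat"
  assumes "n \<ge> 1" and "\<pi> permutes {0..<n}"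
  shows "cyclically_equalizable {0..<n} [0..<n] (map \<pi> [0..<n])"
proof -
  define \<sigma> where "\<sigma> = inv \<pi>"
  have \<sigma>: "\<sigma> permutes {0..<n}" unfolding \<sigma>_def using assms(2) by (rule permutes_inv)
  have \<pi>\<sigma>: "\<pi> (\<sigma> i) = i" for i
    unfolding \<sigma>_def using permutes_inverses(1)[OF assms(2)] .
  have \<pi>_less: "\<pi> i < n" if "i < n" for i
    using permutes_in_image[OF assms(2)] that by simp
  have \<sigma>_less: "(\<sigma> ^^ s) c < n" if "c < n" for s c
    using permutes_in_image[OF \<sigma>] that by (induction s) auto
  obtain L where L: "\<And>c. c < n \<Longrightarrow> L c \<le> n" "\<And>c. (\<sigma> ^^ L c) c = c"
    and ex: "\<And>i. i < n \<Longrightarrow> \<exists>s c. c < n \<and> s < L c \<and> (\<sigma> ^^ s) c = i"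
    and uniq: "\<And>c d s t. s < L c \<Longrightarrow> t < L d \<Longrightarrow> (\<sigma> ^^ s) c = (\<sigma> ^^ t) d \<Longrightarrow> s = t \<and> c = d"
    using permutes_cycle_coordinates[OF \<sigma>] by blast
  \<comment> \<open>As \<open>s\<close> decreases along an orbit, the element enumerated last is met
    first. It equals \<open>\<pi> c\<close>, the default value in \<open>U\<close> and
    \<open>V\<close> for sweeps with \<open>s \<ge> L c\<close>.\<close>
  have \<pi>_wrap: "\<pi> c = (\<sigma> ^^ m) c" if "L c = Suc m" for c m
    using L(2)[of c] that by (metis \<pi>\<sigma> funpow.simps(2) o_apply)
  from ex have "\<forall>i\<in>{..<n}. \<exists>s c. c < n \<and> s < L c \<and> (\<sigma> ^^ s) c = i" by blast
  then obtain S C where SC: "\<And>i. i < n \<Longrightarrow> C i < n \<and> S i < L (C i) \<and> (\<sigma> ^^ S i) (C i) = i"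
    unfolding bchoice_iff by (metis lessThan_iff)
  have S_less: "S i < n" if "i < n" for i
    using SC[OF that] L(1)[of "C i"] by simp
  define e where "e q s c = (q * n + s) * n + c" for q s c
  define N where "N = n * n * n + n"
  define p where "p i = e i (S i) (C i)" for i
  \<comment> \<open>The letter at position \<open>(q, s, c)\<close> is the original letter met next along the
    orbit, where a letter at \<open>(q, s, c)\<close> itself counts for \<open>U\<close> but not for \<open>V\<close>.\<close>
  define U where "U q s c =
    (if s < L c then if q \<le> (\<sigma> ^^ s) c then (\<sigma> ^^ s) c else \<pi> ((\<sigma> ^^ s) c) else \<pi> c)" for q s c
  define V where "V q s c =
    (if s < L c then if q < (\<sigma> ^^ s) c then (\<sigma> ^^ s) c else \<pi> ((\<sigma> ^^ s) c) else \<pi> c)" for q s c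
  define dec :: "(nat \<Rightarrow> nat \<Rightarrow> nat \<Rightarrow> nat) \<Rightarrow> nat \<Rightarrow> nat"
    where "dec f j = f (j div (n * n)) (j div n mod n) (j mod n)" for f j
  have dec_e: "dec f (e q s c) = f q s c" if "s < n" "c < n" for f q s c
    unfolding dec_def e_def digits[OF that] ..
  have e_cases: "\<exists>q s c. j = e q s c \<and> s < n \<and> c < n" for j
  proof -
    have "j = e (j div (n * n)) (j div n mod n) (j mod n)"
      by (simp add: e_def div_mult2_eq)
    with assms(1) show ?thesis
      by (metis le_zero_eq mod_less_divisor not_gr_zero zero_neq_one)
  qed
  have e_less: "e q s c < Suc q * n * n" if "s < n" "c < n" for q s c
  proof -
    have "e q s c < Suc (q * n + s) * n" using that by (simp add: e_def)
    also have "\<dots> \<le> (Suc q * n) * n" using that by (intro mult_right_mono) auto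
    finally show ?thesis .
  qed
  have e_ge: "q * n * n \<le> e q s c" for q s c by (simp add: e_def algebra_simps)
  have p_bounds: "i * n * n \<le> p i" "p i < Suc i * n * n" if "i < n" for i
    using e_less e_ge SC S_less that by (auto simp: p_def)
  have mono: "strict_mono_on {..<n} p"
  proof (rule strict_mono_onI)
    fix i k assume *: "i \<in> {..<n}" "k \<in> {..<n}" "i < k"
    then have "p i < Suc i * n * n" using p_bounds(2) by simp
    also have "\<dots> \<le> k * n * n" using * by (intro mult_right_mono) auto
    also have "\<dots> \<le> p k" using * p_bounds(1) by simp
    finally show "p i < p k" .
  qed
  have p_less: "p i < N" if "i < n" for i
  proof -
    have "p i < Suc i * n * n" using that p_bounds(2) by simp
    also have "\<dots> \<le> n * n * n" using that by (intro mult_right_mono) auto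
    finally show ?thesis by (simp add: N_def)
  qed
  \<comment> \<open>\<open>U\<close> and \<open>V\<close> can differ only if \<open>s < L c\<close>
    and \<open>q = (\<sigma> ^^ s) c\<close>; uniqueness of the coordinates makes such a position a
    mark.\<close>
  have UV: "dec V j = dec U j" if "j \<notin> p ` {..<n}" for j
  proof -
    obtain q s c where j: "j = e q s c" "s < n" "c < n" using e_cases by blast
    have False if *: "s < L c" "(\<sigma> ^^ s) c = q"
    proof -
      have "q < n" using \<sigma>_less[OF j(3)] * by blast
      with uniq[of s c "S q" "C q"] SC * have "s = S q" "c = C q" by auto
      with j \<open>q < n\<close> \<open>j \<notin> p ` {..<n}\<close> show False by (auto simp: p_def)
    qed
    with j show ?thesis by (auto simp: dec_e U_def V_def)
  qed
  define x where "x = gap p (dec U) n N"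
  have insU: "insertion x [0..<n] = map (dec U) [0..<N]"
    unfolding x_def using SC S_less
    by (intro insertion_gap mono p_less) (auto simp: p_def dec_e U_def)
  have insV: "insertion x (map \<pi> [0..<n]) = map (dec V) [0..<N]"
    unfolding x_def using SC S_less
    by (intro insertion_gap mono p_less UV) (auto simp: p_def dec_e V_def)
  \<comment> \<open>Adding \<open>n * n\<close> raises the leading digit by one; if \<open>N\<close>
    is then subtracted, the sweep number drops by one.\<close>
  have shift: "dec V j = dec U ((j + n * n) mod N)" if jN: "j < N" for j
  proof -
    obtain q s c where j: "j = e q s c" and sc: "s < n" "c < n" using e_cases by blast
    have e_less_N: "e q' t c < N" if "q' * n + t \<le> n * n" for q' t
    proof -
      have "(q' * n + t) * n \<le> (n * n) * n" using that by (rule mult_right_mono) simp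
      with sc show ?thesis unfolding e_def N_def by (intro add_le_less_mono)
    qed
    have eq: "j + n * n = e (Suc q) s c" by (simp add: j e_def algebra_simps)
    have upper: "q * n + s \<le> n * n"
    proof (rule ccontr)
      assume "\<not> q * n + s \<le> n * n"
      then have "Suc (n * n) * n \<le> (q * n + s) * n" by (intro mult_right_mono) auto
      with jN show False by (simp add: j e_def N_def)
    qed
    \<comment> \<open>Since \<open>N = (n * n + 1) * n\<close>, the leading digit \<open>n\<close>
      occurs only with \<open>s = 0\<close>. From there the orbit restarts at
      \<open>(0, n - 1, c)\<close>.\<close>
    consider (inner) "j + n * n < N" | (wrap) s' where "Suc q = n" "s = Suc s'" | (last) "q = n" "s = 0"
    proof (cases "Suc q * n + s \<le> n * n")
      case True
      then show ?thesis using e_less_N[of "Suc q" s] that(1) by (simp add: eq)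
    next
      case False
      with sc have "n * n < (q + 2) * n" by simp
      then have "n < q + 2" by (metis mult_less_cancel2)
      moreover have "q * n \<le> n * n" using upper by linarith
      then have "q \<le> n" using sc by simp
      ultimately consider "q = n" | "Suc q = n" by linarith
      then show ?thesis
      proof cases
        case 1
        with upper that(3) show ?thesis by simp
      next
        case 2
        with False that(2) show ?thesis by (cases s) auto
      qed
    qed
    then show ?thesis
    proof cases
      case inner
      have "V q s c = U (Suc q) s c" by (simp add: U_def V_def Suc_le_eq)
      then have "dec V j = dec U (j + n * n)" unfolding eq using sc by (simp add: j dec_e)
      with inner show ?thesis by simp
    next
      case wrap
      have s': "s' < n" using sc wrap by simp
      have "e n s c = N + e 0 s' c" using wrap by (simp add: e_def N_def algebra_simps)
      moreover have "e 0 s' c < N" using e_less_N[of 0 s'] s' le_square[of n] by simp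
      ultimately have "(j + n * n) mod N = e 0 s' c" using wrap by (simp add: eq)
      \<comment> \<open>With \<open>q = n - 1\<close> any mark of sweep \<open>s\<close> has been
        reached, and at \<open>q = 0\<close> none of sweep \<open>s'\<close> has been
        passed.\<close>
      moreover have "V q s c = U 0 s' c"
      proof -
        have "(\<sigma> ^^ s) c < n" by (rule \<sigma>_less) fact
        moreover have "\<pi> ((\<sigma> ^^ s) c) = (\<sigma> ^^ s') c" using wrap by (simp add: \<pi>\<sigma>)
        moreover have "L c = Suc s'" if "s' < L c" "\<not> s < L c" using that wrap by simp
        ultimately show ?thesis using wrap \<pi>_wrap[of c s'] by (auto simp: U_def V_def)
      qed
      ultimately show ?thesis using sc s' by (simp add: j dec_e)
    next
      case last
      obtain m where m: "n = Suc m" using sc by (cases n) auto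
      have "j + n * n = N + e 0 m c" by (simp add: j last e_def N_def m algebra_simps)
      moreover have "e 0 m c < N" using e_less_N[of 0 m] m by simp
      ultimately have "(j + n * n) mod N = e 0 m c" by simp
      \<comment> \<open>The sweep \<open>m = n - 1\<close> carries a mark only if
        \<open>L c = n\<close>, that is, for a cycle of full length.\<close>
      moreover have "V q s c = U 0 m c"
      proof -
        have "\<pi> c = (\<sigma> ^^ m) c" if "m < L c"
          using that L(1)[OF sc(2)] m by (intro \<pi>_wrap) simp
        with last sc show ?thesis by (auto simp: U_def V_def)
      qed
      ultimately show ?thesis using sc m by (simp add: j dec_e)
    qed
  qed
  have "map (dec V) [0..<N] = rotate (n * n) (map (dec U) [0..<N])"
    by (rule nth_equalityI) (auto simp: nth_rotate shift add.commute)
  then have "cyclically_equivalent (insertion x [0..<n]) (insertion x (map \<pi> [0..<n]))"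
    unfolding cyclically_equivalent_def insU insV by blast
  moreover have "dec U j < n" for j
  proof -
    obtain q s c where "j = e q s c" "s < n" "c < n" using e_cases by blast
    then show ?thesis by (simp add: dec_e U_def \<pi>_less \<sigma>_less)
  qed
  then have "x i \<in> lists {0..<n}" for i by (auto simp: x_def gap_def in_lists_conv_set)
  moreover have "[0..<n] \<in> lists {0..<n}" "map \<pi> [0..<n] \<in> lists {0..<n}"
    using \<pi>_less by (auto simp: in_lists_conv_set)
  ultimately show ?thesis unfolding cyclically_equalizable_def by auto
qed

end
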